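(* Let $n\ge 2$ and $k\ge 3$ be integers. Set $X=\{2j : 0\le j<n\}$, $m=2(k+1)n-2$, $Y=m-X=\{m-x : x\in X\}$, $Z=\{2jn-1 : 1\le j\le k\}$, $B=X\sqcup Y\sqcup Z$, $a^*=2n$, $A^*=B\sqcup\{a^*\}$, $a=m+2$, and $A=A^*\sqcup\{a\}$. Then $|A^*+A^*|>|A^*-A^*|$ and $|A+A|>|A-A|$; more precisely $|A^*+A^*|-|A^*-A^*|=|A+A|-|A-A|=1$.
   Context: For $A\subseteq\mathbb{Z}$, $A+A=\{a_1+a_2 : a_1,a_2\in A\}$ and $A-A=\{a_1-a_2 : a_1,a_2\in A\}$. *)

theory Defs
  imports Main "HOL-Library.Set_Algebras"
begin

(* Sums of sets are those of Set_Algebras. It has no counterpart for differences: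
   on sets, the symbol - is the set-theoretic difference. *)

definition diffset :: "int set \<Rightarrow> int set \<Rightarrow> int set" where
  "diffset S T = {s - t | s t. s \<in> S \<and> t \<in> T}"

lemma sumset_eq: "S + T = {s + t | s t. s \<in> S \<and> t \<in> T}" for S T :: "int set"
  by (auto simp: set_plus_def)

definition m_val :: "int \<Rightarrow> int \<Rightarrow> int" where
  "m_val n k = 2 * (k + 1) * n - 2"

definition X_set :: "int \<Rightarrow> int set" where
  "X_set n = {2 * j | j. 0 \<le> j \<and> j < n}"

definition Y_set :: "int \<Rightarrow> int \<Rightarrow> int set" where
  "Y_set n k = {m_val n k - x | x. x \<in> X_set n}"

definition Z_set :: "int \<Rightarrow> int \<Rightarrow> int set" where
  "Z_set n k = {2 * j * n - 1 | j. 1 \<le> j \<and> j \<le> k}"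

definition B_set :: "int \<Rightarrow> int \<Rightarrow> int set" where
  "B_set n k = X_set n \<union> Y_set n k \<union> Z_set n k"

definition a_star :: "int \<Rightarrow> int" where
  "a_star n = 2 * n"

definition A_star :: "int \<Rightarrow> int \<Rightarrow> int set" where
  "A_star n k = B_set n k \<union> {a_star n}"

definition a_val :: "int \<Rightarrow> int \<Rightarrow> int" where
  "a_val n k = m_val n k + 2"

definition A_set :: "int \<Rightarrow> int \<Rightarrow> int set" where
  "A_set n k = A_star n k \<union> {a_val n k}"

(* The unions above are disjoint in the intended range of parameters. *)

lemma unions_disjoint:
  fixes n k :: int
  assumes "n \<ge> 2" and "k \<ge> 3"
  shows "X_set n \<inter> Y_set n k = {}"
    and "X_set n \<inter> Z_set n k = {}"
    and "Y_set n k \<inter> Z_set n k = {}"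
    and "a_star n \<notin> B_set n k"
    and "a_val n k \<notin> A_star n k"
proof -
  have kn: "3 * n \<le> k * n"
    using assms by (intro mult_right_mono) auto
  have X: "even x \<and> 0 \<le> x \<and> x \<le> 2 * n - 2" if "x \<in> X_set n" for x
    using that by (auto simp: X_set_def)
  have m: "m_val n k = 2 * (k * n) + 2 * n - 2"
    by (simp add: m_val_def algebra_simps)
  have Y: "even y \<and> 2 * (k * n) \<le> y \<and> y \<le> m_val n k" if y: "y \<in> Y_set n k" for y
  proof -
    obtain x where "x \<in> X_set n" "y = m_val n k - x"
      using y by (auto simp: Y_set_def)
    with X[of x] m show ?thesis by auto
  qed
  have Z: "odd z" if "z \<in> Z_set n k" for z
    using that by (auto simp: Z_set_def)
  show "X_set n \<inter> Y_set n k = {}"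
  proof -
    have False if "x \<in> X_set n" "x \<in> Y_set n k" for x
      using X[OF that(1)] Y[OF that(2)] kn assms by linarith
    then show ?thesis by blast
  qed
  show "X_set n \<inter> Z_set n k = {}" "Y_set n k \<inter> Z_set n k = {}"
    using X Y Z by blast+
  have "2 * n \<notin> X_set n" using X[of "2 * n"] by auto
  moreover have "2 * n \<notin> Y_set n k" using Y[of "2 * n"] kn assms by auto
  moreover have "2 * n \<notin> Z_set n k" using Z[of "2 * n"] by auto
  ultimately show "a_star n \<notin> B_set n k"
    by (simp add: B_set_def a_star_def)
  have "m_val n k + 2 \<notin> X_set n" using X[of "m_val n k + 2"] m kn assms by auto
  moreover have "m_val n k + 2 \<notin> Y_set n k" using Y[of "m_val n k + 2"] by auto
  moreover have "m_val n k + 2 \<notin> Z_set n k" using Z[of "m_val n k + 2"] m by auto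
  moreover have "m_val n k + 2 \<noteq> 2 * n" using m kn assms by auto
  ultimately show "a_val n k \<notin> A_star n k"
    by (simp add: A_star_def B_set_def a_star_def a_val_def)
qed

end

theory Submission
  imports Defs
begin

text \<open>
  Sort the elements by parity, writing \<open>A\<^sup>*\<close> and \<open>A\<close> as \<open>2E \<union> (2F - 1)\<close>, where
  \<open>F = {n, 2n, \<dots>, kn}\<close> and \<open>E = {0..n} \<union> {kn..(k + 1)n - 1 + d}\<close> with \<open>d = 0\<close> for \<open>A\<^sup>*\<close> and
  \<open>d = 1\<close> for \<open>A\<close>. The odd sums and the odd differences both fill an interval, because the
  intervals in \<open>E\<close> have at least \<open>n\<close> elements; there are \<open>2kn + d\<close> and \<open>2kn + 2d\<close> of them.
  The even sums come from \<open>E + E\<close>, which is three intervals with \<open>6n + 3d\<close> elements, and from the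
  progression \<open>F + F - 1\<close>, which has \<open>2(k - 2)\<close> elements outside these intervals. The even
  differences come from \<open>E - E\<close>, with \<open>6n + 1 + 2d\<close> elements, and \<open>F - F\<close>, which adds only
  \<open>2(k - 3)\<close> more.
\<close>

section \<open>Splitting sets of integers by parity\<close>

definition by_parity :: "int set \<Rightarrow> int set \<Rightarrow> int set" where
  "by_parity E F = (\<lambda>x. 2 * x) ` E \<union> (\<lambda>x. 2 * x - 1) ` F"

definition progression :: "int \<Rightarrow> int \<Rightarrow> int set \<Rightarrow> int set" where
  "progression n c T = (\<lambda>j. c + j * n) ` T"

lemma card_by_parity:
  assumes "finite E" "finite F"
  shows "card (by_parity E F) = card E + card F"
proof -
  have "card (by_parity E F) = card ((\<lambda>x. 2 * x) ` E) + card ((\<lambda>x. 2 * x - 1) ` F)"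
    unfolding by_parity_def using assms by (intro card_Un_disjoint) (auto, presburger)
  then show ?thesis by (simp add: card_image inj_on_def)
qed

lemma sumset_image:
  fixes f g h :: "int \<Rightarrow> int"
  assumes "\<And>x y. x \<in> S \<Longrightarrow> y \<in> T \<Longrightarrow> f x + g y = h (x + y)"
  shows "f ` S + g ` T = h ` (S + T)"
  using assms by (fastforce simp: set_plus_def image_iff)

text \<open>Two odd elements add up to \<open>2 * (x + y - 1)\<close>, hence the shift in the even
  part; mixed sums need none.\<close>

lemma by_parity_sumset:
  "by_parity E F + by_parity E' F' =
    by_parity (E + E' \<union> (\<lambda>x. x - 1) ` (F + F')) (E + F' \<union> (F + E'))"
proof -
  have "(\<lambda>x. 2 * x) ` E + (\<lambda>x. 2 * x) ` E' = (\<lambda>x. 2 * x) ` (E + E')"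
    "(\<lambda>x. 2 * x) ` E + (\<lambda>x. 2 * x - 1) ` F' = (\<lambda>x. 2 * x - 1) ` (E + F')"
    "(\<lambda>x. 2 * x - 1) ` F + (\<lambda>x. 2 * x) ` E' = (\<lambda>x. 2 * x - 1) ` (F + E')"
    "(\<lambda>x. 2 * x - 1) ` F + (\<lambda>x. 2 * x - 1) ` F' = (\<lambda>x. 2 * (x - 1)) ` (F + F')"
    by (rule sumset_image; simp)+
  then show ?thesis
    by (simp add: by_parity_def Un_set_plus set_plus_Un image_Un image_image Un_ac)
qed

lemma by_parity_uminus:
  "uminus ` by_parity E F = by_parity (uminus ` E) ((\<lambda>x. 1 - x) ` F)"
  by (simp add: by_parity_def image_Un image_image)

text \<open>Lets the lemmas on sums serve for differences as well.\<close>

lemma diffset_eq_sumset: "diffset S T = S + uminus ` T"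
  by (force simp: diffset_def set_plus_def)

section \<open>Sums of intervals and arithmetic progressions\<close>

lemma atLeastAtMost_sumset:
  fixes a b c d :: int
  assumes "a \<le> b" "c \<le> d"
  shows "{a..b} + {c..d} = {a + c..b + d}"
proof
  show "{a + c..b + d} \<subseteq> {a..b} + {c..d}"
  proof
    fix x assume x: "x \<in> {a + c..b + d}"
    \<comment> \<open>The first summand is the least element of \<open>{a..b}\<close> that leaves at
      most \<open>d\<close>.\<close>
    have "x = max a (x - d) + min d (x - a)" by auto
    moreover have "max a (x - d) \<in> {a..b}" "min d (x - a) \<in> {c..d}" using x assms by auto
    ultimately show "x \<in> {a..b} + {c..d}" by (metis set_plus_intro)
  qed
qed (auto simp: set_plus_def)

lemma progression_sumset:
  "progression n c S + progression n d T = progression n (c + d) (S + T)"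
  by (force simp: progression_def set_plus_def algebra_simps image_iff)

text \<open>Translates of the interval by consecutive multiples of \<open>n\<close> overlap or abut,
  since it has at least \<open>n\<close> elements.\<close>

lemma atLeastAtMost_plus_progression:
  fixes a b n :: int
  assumes n: "n > 0" and len: "n \<le> b - a + 1" and pq: "p \<le> q"
  shows "{a..b} + progression n c {p..q} = {a + c + p * n..b + c + q * n}"
proof
  show "{a..b} + progression n c {p..q} \<subseteq> {a + c + p * n..b + c + q * n}"
  proof
    fix x assume "x \<in> {a..b} + progression n c {p..q}"
    then obtain e j where e: "e \<in> {a..b}" and j: "j \<in> {p..q}" and x: "x = e + (c + j * n)"
      by (auto simp: set_plus_def progression_def)
    have "p * n \<le> j * n" "j * n \<le> q * n" using j n by (auto intro: mult_right_mono)
    then show "x \<in> {a + c + p * n..b + c + q * n}" using e x by auto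
  qed
next
  show "{a + c + p * n..b + c + q * n} \<subseteq> {a..b} + progression n c {p..q}"
  proof
    fix x assume x: "x \<in> {a + c + p * n..b + c + q * n}"
    \<comment> \<open>The last translate starting at or before \<open>x\<close> has index
      \<open>t\<close>. If \<open>t\<close> exceeds \<open>q\<close>, the upper bound on
      \<open>x\<close> puts it in the translate of index \<open>q\<close>.\<close>
    define t where "t = (x - c - a) div n"
    have t: "t * n \<le> x - c - a" "x - c - a < t * n + n"
    proof -
      have "x - c - a = t * n + (x - c - a) mod n" by (simp add: t_def)
      then show "t * n \<le> x - c - a" "x - c - a < t * n + n"
        using pos_mod_sign[OF n, of "x - c - a"] pos_mod_bound[OF n, of "x - c - a"] by linarith+
    qed
    have "p * n < (t + 1) * n" using t x by (auto simp: algebra_simps)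
    then have "p \<le> t" using n by (simp add: mult_less_cancel_right)
    have "x - (c + min t q * n) \<in> {a..b}"
    proof (cases "t \<le> q")
      case True
      then show ?thesis using t len by auto
    next
      case False
      then have "q * n \<le> t * n" using n by simp
      then have "a \<le> x - (c + q * n)" "x - (c + q * n) \<le> b"
        using t x unfolding atLeastAtMost_iff by linarith+
      then show ?thesis using False by simp
    qed
    moreover have "min t q \<in> {p..q}" using \<open>p \<le> t\<close> pq by auto
    then have "c + min t q * n \<in> progression n c {p..q}" unfolding progression_def by (rule imageI)
    ultimately have "x - (c + min t q * n) + (c + min t q * n) \<in> {a..b} + progression n c {p..q}"
      by (rule set_plus_intro)
    then show "x \<in> {a..b} + progression n c {p..q}" by simp
  qed
qed

lemma card_progression:
  assumes "n \<noteq> 0"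
  shows "card (progression n c T) = card T"
  using assms by (simp add: progression_def card_image inj_on_def)

lemma finite_progression [simp]: "finite T \<Longrightarrow> finite (progression n c T)"
  by (simp add: progression_def)

lemma progression_Un: "progression n c (S \<union> T) = progression n c S \<union> progression n c T"
  by (auto simp: progression_def)

section \<open>Both sets as one family with parameter \<open>d\<close>\<close>

locale sum_dominant_family =
  fixes n k d :: int
  assumes n: "n \<ge> 2" and k: "k \<ge> 3" and d: "0 \<le> d" "d \<le> 1"
begin

text \<open>The halves of \<open>X_set\<close> and \<open>Y_set\<close>, where \<open>a_star\<close>
  adds \<open>n\<close> to the first interval and, if \<open>d = 1\<close>, \<open>a_val\<close>
  adds \<open>k * n + n\<close> to the second.\<close>

definition E :: "int set" where "E = {0..n} \<union> {k * n..k * n + n - 1 + d}"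
definition F :: "int set" where "F = progression n 0 {1..k}"

\<comment> \<open>The shape keeps the simplifier from cancelling \<open>n\<close>.\<close>
lemma kn: "3 * n - 1 < k * n"
proof -
  have "3 * n \<le> k * n" using n k by (intro mult_right_mono) auto
  then show ?thesis by linarith
qed

lemma uminus_E: "uminus ` E = {-n..0} \<union> {- (k * n) - n + 1 - d..- (k * n)}"
  by (simp add: E_def image_Un algebra_simps)

text \<open>Negating the indices instead of the step keeps the step \<open>n\<close>, as
  \<open>progression_sumset\<close> requires a common step.\<close>

lemma one_minus_F: "(\<lambda>x. 1 - x) ` F = progression n 1 {-k..-1}"
proof -
  have "(\<lambda>x. 1 - x) ` F = progression n 1 (uminus ` {1..k})"
    by (simp add: F_def progression_def image_image del: image_uminus_atLeastAtMost)
  then show ?thesis by simp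
qed

text \<open>Of the \<open>2 * k - 1\<close> terms \<open>t * n - 1\<close>, only those with
  \<open>t\<close> equal to 2, \<open>k + 1\<close> or \<open>k + 2\<close> lie in
  \<open>E + E\<close>. The offset -1 puts the terms for \<open>k\<close> and \<open>2 * k\<close>
  just below the last two intervals.\<close>

lemma sumset_even:
  "E + E \<union> (\<lambda>x. x - 1) ` (F + F) =
    {0..2 * n} \<union> {k * n..k * n + 2 * n - 1 + d} \<union> {2 * (k * n)..2 * (k * n) + 2 * n - 2 + 2 * d}
    \<union> progression n (-1) ({3..k} \<union> {k + 3..2 * k})"
proof -
  have "(\<lambda>x. x - 1) ` (F + F) = progression n (-1) {2..2 * k}"
    using k by (simp add: F_def progression_sumset atLeastAtMost_sumset)
      (simp add: progression_def image_image)
  also have "{2..2 * k} = {2, k + 1, k + 2} \<union> ({3..k} \<union> {k + 3..2 * k})"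
    using k by auto
  finally have FF: "(\<lambda>x. x - 1) ` (F + F) =
    {2 * n - 1, k * n + n - 1, k * n + 2 * n - 1} \<union> progression n (-1) ({3..k} \<union> {k + 3..2 * k})"
    by (simp only: progression_Un) (simp add: progression_def algebra_simps)
  have EE: "E + E = {0..2 * n} \<union> {k * n..k * n + 2 * n - 1 + d}
    \<union> {2 * (k * n)..2 * (k * n) + 2 * n - 2 + 2 * d}"
    using n d kn unfolding E_def Un_set_plus set_plus_Un
    by (simp add: atLeastAtMost_sumset algebra_simps) blast
  have "{2 * n - 1, k * n + n - 1, k * n + 2 * n - 1} \<subseteq> E + E"
    unfolding EE using n d kn by auto
  then show ?thesis unfolding FF EE by blast
qed

lemma card_sumset_even:
  "int (card (E + E \<union> (\<lambda>x. x - 1) ` (F + F))) = 6 * n + 3 * d + 2 * (k - 2)"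
proof -
  let ?I = "{0..2 * n}" and ?J = "{k * n..k * n + 2 * n - 1 + d}"
    and ?K = "{2 * (k * n)..2 * (k * n) + 2 * n - 2 + 2 * d}"
    and ?P = "progression n (-1) ({3..k} \<union> {k + 3..2 * k})"
  have "x \<notin> ?I \<union> ?J \<union> ?K" if "x \<in> ?P" for x
  proof -
    from that obtain t where t: "t \<in> {3..k} \<union> {k + 3..2 * k}" and x: "x = -1 + t * n"
      unfolding progression_def by blast
    \<comment> \<open>The first index range falls in the gap between \<open>?I\<close> and
      \<open>?J\<close>, the second in the gap between \<open>?J\<close> and
      \<open>?K\<close>.\<close>
    from t consider "3 \<le> t" "t \<le> k" | "k + 3 \<le> t" "t \<le> 2 * k" by auto
    then show ?thesis
    proof cases
      case 1
      then have "3 * n \<le> t * n" "t * n \<le> k * n"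
        using n by - (rule mult_right_mono; simp)+
      then show ?thesis
        using n d kn unfolding x left_diff_distrib distrib_right Un_iff atLeastAtMost_iff by linarith
    next
      case 2
      then have "(k + 3) * n \<le> t * n" "t * n \<le> (2 * k) * n"
        using n by - (rule mult_right_mono; simp)+
      then show ?thesis
        using n d kn unfolding x left_diff_distrib distrib_right Un_iff atLeastAtMost_iff by linarith
    qed
  qed
  then have "card (?I \<union> ?J \<union> ?K \<union> ?P) = card (?I \<union> ?J \<union> ?K) + card ?P"
    by (intro card_Un_disjoint) auto
  also have "card (?I \<union> ?J \<union> ?K) = card (?I \<union> ?J) + card ?K"
    using n k d kn by (intro card_Un_disjoint) auto
  also have "card (?I \<union> ?J) = card ?I + card ?J"
    using n k d kn by (intro card_Un_disjoint) auto
  also have "card ?P = card {3..k} + card {k + 3..2 * k}"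
    using n k by (subst card_progression, simp, intro card_Un_disjoint) auto
  finally show ?thesis unfolding sumset_even using n k d by simp
qed

text \<open>Each interval of \<open>E\<close> plus \<open>F\<close> is an interval; the two share
  the point \<open>k * n + n\<close>.\<close>

lemma sumset_odd: "E + F = {n..2 * (k * n) + n - 1 + d}"
proof -
  have "E + F = {n..k * n + n} \<union> {k * n + n..2 * (k * n) + n - 1 + d}"
    using n k d unfolding E_def F_def Un_set_plus
    by (simp add: atLeastAtMost_plus_progression) (simp add: algebra_simps)
  then show ?thesis using n d kn by auto
qed

text \<open>The offset is now 0, so the intervals absorb five of the \<open>2 * k - 1\<close>
  multiples of \<open>n\<close>, two more than for sums: the outermost two are endpoints of the
  outer intervals.\<close>

lemma diffset_even:
  "E + uminus ` E \<union> (\<lambda>x. x - 1) ` (F + (\<lambda>x. 1 - x) ` F) =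
    {-n..n} \<union> {k * n - n..k * n + n - 1 + d} \<union> {- (k * n) - n + 1 - d..- (k * n) + n}
    \<union> progression n 0 ({2..k - 2} \<union> {2 - k..-2})"
proof -
  have "(\<lambda>x. x - 1) ` (F + (\<lambda>x. 1 - x) ` F) = progression n 0 {1 - k..k - 1}"
    using k unfolding one_minus_F by (simp add: F_def progression_sumset atLeastAtMost_sumset)
      (simp add: progression_def image_image)
  also have "{1 - k..k - 1} = {0, 1, -1, k - 1, 1 - k} \<union> ({2..k - 2} \<union> {2 - k..-2})"
    using k by auto
  finally have FF: "(\<lambda>x. x - 1) ` (F + (\<lambda>x. 1 - x) ` F) =
    {0, n, -n, k * n - n, n - k * n} \<union> progression n 0 ({2..k - 2} \<union> {2 - k..-2})"
    by (simp only: progression_Un) (simp add: progression_def algebra_simps)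
  have "E + uminus ` E = {-n..n} \<union> {- (k * n) - n + 1 - d..- (k * n) + n}
    \<union> ({k * n - n..k * n + n - 1 + d} \<union> {1 - n - d..n - 1 + d})"
    using n d kn unfolding uminus_E unfolding E_def Un_set_plus set_plus_Un
    by (simp add: atLeastAtMost_sumset algebra_simps) blast
  \<comment> \<open>As \<open>d \<le> 1\<close>, the upper interval of \<open>E\<close> has at most
    \<open>n + 1\<close> elements, so its own differences stay within
    \<open>{-n..n}\<close>.\<close>
  also have "\<dots> = {-n..n} \<union> {k * n - n..k * n + n - 1 + d}
    \<union> {- (k * n) - n + 1 - d..- (k * n) + n}"
    using d by auto
  finally have EE: "E + uminus ` E = \<dots>" .
  have "{0, n, -n, k * n - n, n - k * n} \<subseteq> E + uminus ` E"
    unfolding EE using n d kn by auto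
  then show ?thesis unfolding FF EE by blast
qed

lemma card_diffset_even:
  "int (card (E + uminus ` E \<union> (\<lambda>x. x - 1) ` (F + (\<lambda>x. 1 - x) ` F))) =
    6 * n + 1 + 2 * d + 2 * (k - 3)"
proof -
  let ?I = "{-n..n}" and ?J = "{k * n - n..k * n + n - 1 + d}"
    and ?K = "{- (k * n) - n + 1 - d..- (k * n) + n}"
    and ?P = "progression n 0 ({2..k - 2} \<union> {2 - k..-2})"
  have "x \<notin> ?I \<union> ?J \<union> ?K" if "x \<in> ?P" for x
  proof -
    from that obtain t where t: "t \<in> {2..k - 2} \<union> {2 - k..-2}" and x: "x = 0 + t * n"
      unfolding progression_def by blast
    \<comment> \<open>Positive indices fall in the gap between \<open>?I\<close> and
      \<open>?J\<close>, negative ones between \<open>?K\<close> and \<open>?I\<close>.\<close>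
    from t consider "2 \<le> t" "t \<le> k - 2" | "2 - k \<le> t" "t \<le> -2" by auto
    then show ?thesis
    proof cases
      case 1
      then have "2 * n \<le> t * n" "t * n \<le> (k - 2) * n"
        using n by - (rule mult_right_mono; simp)+
      then show ?thesis
        using n d kn unfolding x left_diff_distrib distrib_right Un_iff atLeastAtMost_iff by linarith
    next
      case 2
      then have "(2 - k) * n \<le> t * n" "t * n \<le> (-2) * n"
        using n by - (rule mult_right_mono; simp)+
      then show ?thesis
        using n d kn unfolding x left_diff_distrib distrib_right Un_iff atLeastAtMost_iff by linarith
    qed
  qed
  then have "card (?I \<union> ?J \<union> ?K \<union> ?P) = card (?I \<union> ?J \<union> ?K) + card ?P"
    by (intro card_Un_disjoint) auto
  also have "card (?I \<union> ?J \<union> ?K) = card (?I \<union> ?J) + card ?K"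
    using n k d kn by (intro card_Un_disjoint) auto
  also have "card (?I \<union> ?J) = card ?I + card ?J"
    using n k d kn by (intro card_Un_disjoint) auto
  also have "card ?P = card {2..k - 2} + card {2 - k..-2}"
    using n k by (subst card_progression, simp, intro card_Un_disjoint) auto
  finally show ?thesis unfolding diffset_even using n k d by simp
qed

text \<open>E - F gains from \<open>d\<close> only at the top and F - E only at the bottom, so the
  range grows by \<open>2 * d\<close>, against \<open>d\<close> for the odd sums.\<close>

lemma diffset_odd:
  "E + (\<lambda>x. 1 - x) ` F \<union> (F + uminus ` E) = {1 - k * n - d..k * n + d}"
proof -
  have "E + (\<lambda>x. 1 - x) ` F = {1 - k * n..1} \<union> {1..k * n + d}"
    using n k d unfolding one_minus_F E_def Un_set_plus
    by (simp add: atLeastAtMost_plus_progression)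
  moreover have "uminus ` E + F = {0..k * n} \<union> {1 - k * n - d..0}"
    using n k d unfolding uminus_E F_def Un_set_plus
    by (simp add: atLeastAtMost_plus_progression) (simp add: algebra_simps)
  ultimately show ?thesis using n d kn by (subst add.commute[of F]) auto
qed

text \<open>The even part contributes an excess of \<open>d + 1\<close>, the odd part
  \<open>- d\<close>.\<close>

lemma card_sumset_minus_card_diffset:
  assumes S: "S = by_parity E F"
  shows "int (card (S + S)) - int (card (diffset S S)) = 1"
proof -
  have fin: "finite E" "finite F" by (simp_all add: E_def F_def)
  have "int (card (S + S)) = 6 * n + 3 * d + 2 * (k - 2) + int (card (E + F))"
    unfolding S by_parity_sumset add.commute[of F E] Un_absorb
    by (subst card_by_parity) (auto simp: fin finite_set_plus card_sumset_even)
  moreover have "int (card (diffset S S)) = 6 * n + 1 + 2 * d + 2 * (k - 3)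
      + int (card (E + (\<lambda>x. 1 - x) ` F \<union> (F + uminus ` E)))"
    unfolding S diffset_eq_sumset by_parity_uminus by_parity_sumset
    by (subst card_by_parity) (auto simp: fin finite_set_plus card_diffset_even)
  ultimately show ?thesis using n d kn by (simp add: sumset_odd diffset_odd)
qed

end

section \<open>Identifying the original sets with members of the family\<close>

lemma X_set_eq: "X_set n = (\<lambda>x. 2 * x) ` {0..n - 1}"
  by (auto simp: X_set_def)

lemma Y_set_eq: "Y_set n k = (\<lambda>x. 2 * x) ` {k * n..k * n + n - 1}"
proof -
  have "Y_set n k = (\<lambda>x. m_val n k - x) ` X_set n"
    by (auto simp: Y_set_def)
  \<comment> \<open>Since \<open>m_val n k\<close> is twice \<open>k * n + n - 1\<close>, halving
    turns \<open>m_val n k - x\<close> into a reflection of \<open>{0..n - 1}\<close>.\<close>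
  also have "\<dots> = (\<lambda>x. 2 * x) ` (\<lambda>x. (k * n + n - 1) - x) ` {0..n - 1}"
    by (simp add: X_set_eq m_val_def image_image algebra_simps)
  finally show ?thesis by simp
qed

text \<open>Coding odd numbers as \<open>2 * x - 1\<close> gives this progression offset 0.\<close>

lemma Z_set_eq: "Z_set n k = (\<lambda>x. 2 * x - 1) ` progression n 0 {1..k}"
  unfolding progression_def image_image by (auto simp: Z_set_def mult.assoc)

theorem theorem5:
  fixes n k :: int
  assumes "n \<ge> 2" and "k \<ge> 3"
  shows "card (A_star n k + A_star n k) > card (diffset (A_star n k) (A_star n k))
    \<and> card (A_set n k + A_set n k) > card (diffset (A_set n k) (A_set n k))
    \<and> int (card (A_star n k + A_star n k)) - int (card (diffset (A_star n k) (A_star n k))) = 1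
    \<and> int (card (A_set n k + A_set n k)) - int (card (diffset (A_set n k) (A_set n k))) = 1"
proof -
  interpret star: sum_dominant_family n k 0 using assms by unfold_locales auto
  interpret full: sum_dominant_family n k 1 using assms by unfold_locales auto
  have "star.E = {0..n - 1} \<union> {k * n..k * n + n - 1} \<union> {n}"
    unfolding star.E_def using assms by auto
  then have "A_star n k = by_parity star.E star.F"
    by (auto simp: A_star_def B_set_def a_star_def X_set_eq Y_set_eq Z_set_eq
        by_parity_def star.F_def)
  note star = star.card_sumset_minus_card_diffset[OF this]
  have "full.E = {0..n - 1} \<union> {k * n..k * n + n - 1} \<union> {n} \<union> {k * n + n}"
    unfolding full.E_def using assms by auto
  moreover have "a_val n k = 2 * (k * n + n)"
    by (simp add: a_val_def m_val_def algebra_simps)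
  ultimately have "A_set n k = by_parity full.E full.F"
    by (auto simp: A_set_def A_star_def B_set_def a_star_def X_set_eq Y_set_eq Z_set_eq
        by_parity_def full.F_def)
  note full = full.card_sumset_minus_card_diffset[OF this]
  from star full show ?thesis by linarith
qed

end
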